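(* Let $Z$ be a non-degenerate multimatroid and let $\prec$ be a total ordering of its skew classes. Then for every basis $B$ of $Z$, \[ |[B]| = \prod_{\omega\in \mathrm{act}_{\prec}(B)}(|\omega|-1),\] where $[B]$ is the equivalence class of $B$ under $\sim$.
   Context: A carrier is a pair $(U,\Omega)$, $U$ finite, $\Omega$ a partition of $U$ into non-empty skew classes; subtransversals meet each skew class at most once, transversals exactly once; a skew pair is two distinct elements of a skew class. A multimatroid $Z=(U,\Omega,r)$ has a non-negative integer $r$ on subtransversals with (R1) on each transversal, $r$ is a matroid rank function; (R2) for subtransversal $S$ and skew pair $\{x,y\}$ in a skew class disjoint from $S$, $r(S\cup\{x\})+r(S\cup\{y\})-2r(S)\ge1$. Bases are maximal subtransversals $S$ with $r(S)=|S|$; circuits are minimal subtransversals with $r(S)<|S|$. Non-degenerate: each skew class has size $\ge2$ (so bases are transversals). $S_\omega$ is the element of $S\cap\omega$. For basis $B$ and skew class $\omega$, $B\cup\omega$ contains at most one circuit $C(B,\omega)$; $\underline B_\omega$ is the element of $C(B,\omega)-B$. $\prec$ induces an order on any subtransversal with least element $\min$. $\omega$ is active w.r.t. $B$ if $C(B,\omega)$ exists and $\min C(B,\omega)\in\omega$, inactive otherwise; $\mathrm{act}_\prec(B)$, $\mathrm{inact}_\prec(B)$ denote these sets. Bases $B,B'$ satisfy $B\sim B'$ if $\mathrm{act}_\prec(B)=\mathrm{act}_\prec(B')$ and $B_\omega=B'_\omega$ for all $\omega\in\mathrm{inact}_\prec(B)$. *)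

theory Defs
  imports Main "HOL-Library.Disjoint_Sets"
begin

definition carrier_pair :: "'a set \<Rightarrow> 'a set set \<Rightarrow> bool" where
  "carrier_pair U \<Omega> \<longleftrightarrow> finite U \<and> partition_on U \<Omega>"

definition subtransversal :: "'a set \<Rightarrow> 'a set set \<Rightarrow> 'a set \<Rightarrow> bool" where
  "subtransversal U \<Omega> S \<longleftrightarrow> S \<subseteq> U \<and> (\<forall>\<omega>\<in>\<Omega>. card (S \<inter> \<omega>) \<le> 1)"

definition transversal :: "'a set \<Rightarrow> 'a set set \<Rightarrow> 'a set \<Rightarrow> bool" where
  "transversal U \<Omega> T \<longleftrightarrow> T \<subseteq> U \<and> (\<forall>\<omega>\<in>\<Omega>. card (T \<inter> \<omega>) = 1)"

definition matroid_rank_on :: "'a set \<Rightarrow> ('a set \<Rightarrow> nat) \<Rightarrow> bool" where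
  "matroid_rank_on E r \<longleftrightarrow>
     (\<forall>A\<subseteq>E. r A \<le> card A) \<and>
     (\<forall>A B. A \<subseteq> B \<and> B \<subseteq> E \<longrightarrow> r A \<le> r B) \<and>
     (\<forall>A\<subseteq>E. \<forall>B\<subseteq>E. r (A \<union> B) + r (A \<inter> B) \<le> r A + r B)"

text \<open>The rank function is a total function in HOL; its values on sets that are not
  subtransversals are unconstrained and are not used by any of the notions below.\<close>

definition multimatroid :: "'a set \<Rightarrow> 'a set set \<Rightarrow> ('a set \<Rightarrow> nat) \<Rightarrow> bool" where
  "multimatroid U \<Omega> r \<longleftrightarrow>
     carrier_pair U \<Omega> \<and>
     (\<forall>T. transversal U \<Omega> T \<longrightarrow> matroid_rank_on T r) \<and>
     (\<forall>S \<omega> x y. subtransversal U \<Omega> S \<and> \<omega> \<in> \<Omega> \<and> \<omega> \<inter> S = {} \<and> x \<in> \<omega> \<and> y \<in> \<omega> \<and> x \<noteq> y \<longrightarrow>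
        int (r (S \<union> {x})) + int (r (S \<union> {y})) - 2 * int (r S) \<ge> 1)"

definition nondegenerate :: "'a set set \<Rightarrow> bool" where
  "nondegenerate \<Omega> \<longleftrightarrow> (\<forall>\<omega>\<in>\<Omega>. card \<omega> \<ge> 2)"

definition independent :: "'a set \<Rightarrow> 'a set set \<Rightarrow> ('a set \<Rightarrow> nat) \<Rightarrow> 'a set \<Rightarrow> bool" where
  "independent U \<Omega> r S \<longleftrightarrow> subtransversal U \<Omega> S \<and> r S = card S"

definition basis :: "'a set \<Rightarrow> 'a set set \<Rightarrow> ('a set \<Rightarrow> nat) \<Rightarrow> 'a set \<Rightarrow> bool" where
  "basis U \<Omega> r B \<longleftrightarrow>
     independent U \<Omega> r B \<and> (\<forall>S. independent U \<Omega> r S \<and> B \<subseteq> S \<longrightarrow> S = B)"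

definition dependent :: "'a set \<Rightarrow> 'a set set \<Rightarrow> ('a set \<Rightarrow> nat) \<Rightarrow> 'a set \<Rightarrow> bool" where
  "dependent U \<Omega> r S \<longleftrightarrow> subtransversal U \<Omega> S \<and> r S < card S"

definition circuit :: "'a set \<Rightarrow> 'a set set \<Rightarrow> ('a set \<Rightarrow> nat) \<Rightarrow> 'a set \<Rightarrow> bool" where
  "circuit U \<Omega> r C \<longleftrightarrow>
     dependent U \<Omega> r C \<and> (\<forall>S. dependent U \<Omega> r S \<and> S \<subseteq> C \<longrightarrow> S = C)"

definition fund_circuit_exists ::
  "'a set \<Rightarrow> 'a set set \<Rightarrow> ('a set \<Rightarrow> nat) \<Rightarrow> 'a set \<Rightarrow> 'a set \<Rightarrow> bool" where
  "fund_circuit_exists U \<Omega> r B \<omega> \<longleftrightarrow> (\<exists>C. circuit U \<Omega> r C \<and> C \<subseteq> B \<union> \<omega>)"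

text \<open>Meaningful only if \<open>fund_circuit_exists\<close> holds; for a basis \<open>B\<close> and a skew class
  \<open>\<omega>\<close> of a multimatroid there is at most one circuit in \<open>B \<union> \<omega>\<close>.\<close>

definition fund_circuit ::
  "'a set \<Rightarrow> 'a set set \<Rightarrow> ('a set \<Rightarrow> nat) \<Rightarrow> 'a set \<Rightarrow> 'a set \<Rightarrow> 'a set" where
  "fund_circuit U \<Omega> r B \<omega> = (THE C. circuit U \<Omega> r C \<and> C \<subseteq> B \<union> \<omega>)"

text \<open>\<open>R\<close> is a strict order on the skew classes: \<open>(\<omega>, \<omega>') \<in> R\<close> stands for \<open>\<omega> \<prec> \<omega>'\<close>.
  It is lifted to elements through their skew classes; on a subtransversal the lifted
  relation is again a strict total order.\<close>

definition lift_order :: "'a set set \<Rightarrow> ('a set \<times> 'a set) set \<Rightarrow> ('a \<times> 'a) set" where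
  "lift_order \<Omega> R = {(x, y). \<exists>\<omega>\<in>\<Omega>. \<exists>\<omega>'\<in>\<Omega>. x \<in> \<omega> \<and> y \<in> \<omega>' \<and> (\<omega>, \<omega>') \<in> R}"

definition min_elem :: "'a set set \<Rightarrow> ('a set \<times> 'a set) set \<Rightarrow> 'a set \<Rightarrow> 'a" where
  "min_elem \<Omega> R S = (THE x. x \<in> S \<and> (\<forall>y\<in>S. y \<noteq> x \<longrightarrow> (x, y) \<in> lift_order \<Omega> R))"

definition active ::
  "'a set \<Rightarrow> 'a set set \<Rightarrow> ('a set \<Rightarrow> nat) \<Rightarrow> ('a set \<times> 'a set) set \<Rightarrow> 'a set \<Rightarrow> 'a set \<Rightarrow> bool" where
  "active U \<Omega> r R B \<omega> \<longleftrightarrow>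
     fund_circuit_exists U \<Omega> r B \<omega> \<and> min_elem \<Omega> R (fund_circuit U \<Omega> r B \<omega>) \<in> \<omega>"

definition act ::
  "'a set \<Rightarrow> 'a set set \<Rightarrow> ('a set \<Rightarrow> nat) \<Rightarrow> ('a set \<times> 'a set) set \<Rightarrow> 'a set \<Rightarrow> 'a set set" where
  "act U \<Omega> r R B = {\<omega> \<in> \<Omega>. active U \<Omega> r R B \<omega>}"

definition inact ::
  "'a set \<Rightarrow> 'a set set \<Rightarrow> ('a set \<Rightarrow> nat) \<Rightarrow> ('a set \<times> 'a set) set \<Rightarrow> 'a set \<Rightarrow> 'a set set" where
  "inact U \<Omega> r R B = {\<omega> \<in> \<Omega>. \<not> active U \<Omega> r R B \<omega>}"

definition elem_at :: "'a set \<Rightarrow> 'a set \<Rightarrow> 'a" where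
  "elem_at S \<omega> = the_elem (S \<inter> \<omega>)"

definition basis_equiv ::
  "'a set \<Rightarrow> 'a set set \<Rightarrow> ('a set \<Rightarrow> nat) \<Rightarrow> ('a set \<times> 'a set) set \<Rightarrow> ('a set \<times> 'a set) set" where
  "basis_equiv U \<Omega> r R =
     {(B, B'). basis U \<Omega> r B \<and> basis U \<Omega> r B' \<and>
        act U \<Omega> r R B = act U \<Omega> r R B' \<and>
        (\<forall>\<omega>\<in>inact U \<Omega> r R B. elem_at B \<omega> = elem_at B' \<omega>)}"

lemma equiv_basis_equiv: "equiv {B. basis U \<Omega> r B} (basis_equiv U \<Omega> r R)"
proof -
  have *: "inact U \<Omega> r R B = \<Omega> - act U \<Omega> r R B" for B
    by (auto simp: inact_def act_def)
  show ?thesis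
    by (rule equivI) (auto simp: basis_equiv_def * refl_on_def sym_def trans_def)
qed

end

theory Submission
  imports Defs "HOL-Library.FuncSet"
begin

text \<open>A skew class \<open>\<omega>\<close> is active for a basis \<open>B\<close> iff some \<open>x \<in> \<omega>\<close> lies in the closure of the part of
  \<open>B\<close> above \<open>\<omega>\<close>; by (R2) such an \<open>x\<close> is unique, and we say that it is blocked at \<open>\<omega>\<close>.
  If \<open>\<omega>\<close> is active with blocked element \<open>b\<close>, then replacing \<open>B\<^sub>\<omega>\<close> by any element of \<open>\<omega>\<close> other than \<open>b\<close>
  gives a basis with the same blocked elements: if \<open>x\<close> is blocked at a class below \<open>\<omega>\<close> and \<open>S\<close> is the part of
  \<open>B\<close> above that class without \<open>B\<^sub>\<omega>\<close>, then \<open>x\<close> is already in the closure of \<open>S\<close>, as otherwise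
  both \<open>b\<close> and \<open>B\<^sub>\<omega>\<close> would be in the closure of \<open>S \<union> {x}\<close>, against (R2).
  Hence the equivalence class of \<open>B\<close> arises by choosing freely, at every active class, one of the elements that are
  not blocked.\<close>

section \<open>Skew classes, their order, and subtransversals\<close>

locale ordered_multimatroid =
  fixes U :: "'a set" and \<Omega> :: "'a set set" and r :: "'a set \<Rightarrow> nat"
    and R :: "('a set \<times> 'a set) set"
  assumes multimatroid: "multimatroid U \<Omega> r"
    and nondegenerate: "nondegenerate \<Omega>"
    and order: "strict_linear_order_on \<Omega> R"
begin

lemma finite_U: "finite U"
  using multimatroid by (simp add: multimatroid_def carrier_pair_def)

lemma partition: "partition_on U \<Omega>"
  using multimatroid by (simp add: multimatroid_def carrier_pair_def)

lemma finite_classes: "finite \<Omega>"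
  using finite_elements[OF finite_U partition] .

lemma class_subset: "\<omega> \<in> \<Omega> \<Longrightarrow> \<omega> \<subseteq> U"
  using partition by (auto simp: partition_on_def)

lemma class_unique: "\<lbrakk>\<omega> \<in> \<Omega>; \<omega>' \<in> \<Omega>; x \<in> \<omega>; x \<in> \<omega>'\<rbrakk> \<Longrightarrow> \<omega> = \<omega>'"
  using partition by (auto simp: partition_on_def disjoint_def)

lemma in_class: "subtransversal U \<Omega> S \<Longrightarrow> x \<in> S \<Longrightarrow> \<exists>\<omega>\<in>\<Omega>. x \<in> \<omega>"
  using partition unfolding partition_on_def subtransversal_def by blast

lemma prec_trans: "(a, b) \<in> R \<Longrightarrow> (b, c) \<in> R \<Longrightarrow> (a, c) \<in> R"
  using order by (auto simp: strict_linear_order_on_def dest: transD)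

lemma prec_irrefl: "(a, a) \<notin> R"
  using order by (auto simp: strict_linear_order_on_def irrefl_def)

lemma prec_total: "\<lbrakk>a \<in> \<Omega>; b \<in> \<Omega>; a \<noteq> b\<rbrakk> \<Longrightarrow> (a, b) \<in> R \<or> (b, a) \<in> R"
  using order by (auto simp: strict_linear_order_on_def total_on_def)

text \<open>A form without \<open>card\<close>, better suited to automation. Finiteness of
  \<open>U\<close> matters, since an infinite intersection would have \<open>card\<close> 0.\<close>

lemma subtransversal_iff:
  "subtransversal U \<Omega> S \<longleftrightarrow> S \<subseteq> U \<and> (\<forall>\<omega>\<in>\<Omega>. \<forall>x\<in>S \<inter> \<omega>. \<forall>y\<in>S \<inter> \<omega>. x = y)"
proof (cases "S \<subseteq> U")
  case True
  then have "finite (S \<inter> \<omega>)" for \<omega>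
    using finite_U by (meson finite_Int finite_subset)
  then have "card (S \<inter> \<omega>) \<le> 1 \<longleftrightarrow> (\<forall>x\<in>S \<inter> \<omega>. \<forall>y\<in>S \<inter> \<omega>. x = y)" for \<omega>
    using card_le_Suc0_iff_eq[of "S \<inter> \<omega>"] by simp
  then show ?thesis
    by (simp add: subtransversal_def)
next
  case False
  then show ?thesis
    by (simp add: subtransversal_def)
qed

lemma subtransversal_eq:
  "\<lbrakk>subtransversal U \<Omega> S; \<omega> \<in> \<Omega>; x \<in> S; y \<in> S; x \<in> \<omega>; y \<in> \<omega>\<rbrakk> \<Longrightarrow> x = y"
  by (simp add: subtransversal_iff)

lemma subtransversal_inter:
  "\<lbrakk>subtransversal U \<Omega> S; \<omega> \<in> \<Omega>; x \<in> S; x \<in> \<omega>\<rbrakk> \<Longrightarrow> S \<inter> \<omega> = {x}"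
  using subtransversal_eq[of S \<omega> _ x] by blast

lemma transversal_iff:
  "transversal U \<Omega> T \<longleftrightarrow> subtransversal U \<Omega> T \<and> (\<forall>\<omega>\<in>\<Omega>. T \<inter> \<omega> \<noteq> {})"
proof -
  have "card (T \<inter> \<omega>) = 1 \<longleftrightarrow> card (T \<inter> \<omega>) \<le> 1 \<and> T \<inter> \<omega> \<noteq> {}" if "T \<subseteq> U" for \<omega>
  proof -
    have "finite (T \<inter> \<omega>)"
      using finite_U that by (meson finite_Int finite_subset)
    then show ?thesis
      by (metis One_nat_def card_0_eq le_Suc_eq le_zero_eq nat.distinct(1) order_refl)
  qed
  then show ?thesis
    unfolding transversal_def subtransversal_def by blast
qed

lemma subtransversal_finite: "subtransversal U \<Omega> S \<Longrightarrow> finite S"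
  using finite_U by (auto simp: subtransversal_def intro: finite_subset)

lemma subtransversal_subset: "subtransversal U \<Omega> S \<Longrightarrow> S' \<subseteq> S \<Longrightarrow> subtransversal U \<Omega> S'"
  unfolding subtransversal_iff by blast

lemma subtransversal_insert:
  assumes "subtransversal U \<Omega> S" "\<omega> \<in> \<Omega>" "\<omega> \<inter> S = {}" "x \<in> \<omega>"
  shows "subtransversal U \<Omega> (insert x S)"
  using assms class_subset class_unique unfolding subtransversal_iff by blast

text \<open>Classes are non-empty, so a representative can be added for every class that
  \<open>S\<close> misses.\<close>

lemma subtransversal_extend:
  assumes "subtransversal U \<Omega> S"
  obtains T where "transversal U \<Omega> T" "S \<subseteq> T"
proof -
  have "\<forall>\<omega>\<in>\<Omega>. \<exists>x. x \<in> \<omega>"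
    using partition by (metis ex_in_conv partition_on_def)
  then obtain e where e: "\<forall>\<omega>\<in>\<Omega>. e \<omega> \<in> \<omega>"
    by metis
  let ?N = "{\<omega> \<in> \<Omega>. \<omega> \<inter> S = {}}"
  let ?T = "S \<union> e ` ?N"
  have U: "?T \<subseteq> U"
    using assms e class_subset by (auto simp: subtransversal_def)
  have single: "x = y" if "\<omega> \<in> \<Omega>" "x \<in> ?T \<inter> \<omega>" "y \<in> ?T \<inter> \<omega>" for \<omega> x y
  proof (cases "\<omega> \<inter> S = {}")
    case True
    then have "z = e \<omega>" if "z \<in> ?T \<inter> \<omega>" for z
      using that e class_unique \<open>\<omega> \<in> \<Omega>\<close> by blast
    then show ?thesis
      using that by metis
  next
    case False
    then have "z \<in> S" if "z \<in> ?T \<inter> \<omega>" for z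
      using that e class_unique \<open>\<omega> \<in> \<Omega>\<close> by blast
    then show ?thesis
      using that assms unfolding subtransversal_iff by blast
  qed
  have "?T \<inter> \<omega> \<noteq> {}" if "\<omega> \<in> \<Omega>" for \<omega>
    using that e by (cases "\<omega> \<inter> S = {}") auto
  with U single have "transversal U \<Omega> ?T"
    unfolding transversal_iff subtransversal_iff by blast
  then show ?thesis
    using that by blast
qed

section \<open>Rank, closure and independence on subtransversals\<close>

text \<open>(R1) speaks of transversals only, but \<open>S\<close> extends to one and the rank
  axioms pass to subsets.\<close>

lemma matroid_rank_on_subtransversal:
  assumes "subtransversal U \<Omega> S"
  shows "matroid_rank_on S r"
proof -
  obtain T where "transversal U \<Omega> T" "S \<subseteq> T"
    using subtransversal_extend[OF assms] .
  moreover from this have "matroid_rank_on T r"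
    using multimatroid by (simp add: multimatroid_def)
  ultimately show ?thesis
    unfolding matroid_rank_on_def by (meson subset_trans)
qed

lemma rank_le_card: "subtransversal U \<Omega> S \<Longrightarrow> r S \<le> card S"
  using matroid_rank_on_subtransversal by (auto simp: matroid_rank_on_def)

lemma rank_mono: "subtransversal U \<Omega> S \<Longrightarrow> A \<subseteq> S \<Longrightarrow> r A \<le> r S"
  using matroid_rank_on_subtransversal by (auto simp: matroid_rank_on_def)

lemma rank_submodular: "subtransversal U \<Omega> (A \<union> B) \<Longrightarrow> r (A \<union> B) + r (A \<inter> B) \<le> r A + r B"
  using matroid_rank_on_subtransversal[of "A \<union> B"] by (auto simp: matroid_rank_on_def)

lemma rank_union_le:
  assumes "subtransversal U \<Omega> (A \<union> B)"
  shows "r (A \<union> B) \<le> r A + card B"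
  using rank_submodular[OF assms] rank_le_card[of B] subtransversal_subset[OF assms, of B] by simp

lemma rank_insert_le: "subtransversal U \<Omega> (insert x A) \<Longrightarrow> r (insert x A) \<le> r A + 1"
  using rank_union_le[of A "{x}"] by simp

text \<open>The form in which (R2) is used throughout: the closure of \<open>S\<close> contains at
  most one element of a class disjoint from \<open>S\<close>, as two would make the left side of
  (R2) zero.\<close>

lemma rank_insert_unique:
  assumes "subtransversal U \<Omega> S" "\<omega> \<in> \<Omega>" "\<omega> \<inter> S = {}" "x \<in> \<omega>" "y \<in> \<omega>"
    and "r (insert x S) = r S" "r (insert y S) = r S"
  shows "x = y"
proof (rule ccontr)
  assume "x \<noteq> y"
  then have "int (r (S \<union> {x})) + int (r (S \<union> {y})) - 2 * int (r S) \<ge> 1"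
    using multimatroid assms(1-5) unfolding multimatroid_def by blast
  then show False
    using assms(6,7) by simp
qed

text \<open>Monotonicity of closure, by submodularity: for \<open>x \<notin> B\<close>, the sets
  \<open>insert x A\<close> and \<open>B\<close> meet in \<open>A\<close> and have union
  \<open>insert x B\<close>.\<close>

lemma span_mono:
  assumes "r (insert x A) = r A" "A \<subseteq> B" "subtransversal U \<Omega> (insert x B)"
  shows "r (insert x B) = r B"
proof (cases "x \<in> B")
  case True
  then show ?thesis
    by (simp add: insert_absorb)
next
  case False
  then have "insert x A \<union> B = insert x B" "insert x A \<inter> B = A"
    using assms(2) by auto
  then have "r (insert x B) \<le> r B"
    using rank_submodular[of "insert x A" B] assms(1,3) by simp
  moreover have "r B \<le> r (insert x B)"
    using rank_mono[OF assms(3)] by blast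
  ultimately show ?thesis
    by simp
qed

text \<open>Deleting \<open>B - A\<close> lowers the rank by at most
  \<open>card (B - A)\<close>.\<close>

lemma independent_subset:
  assumes "independent U \<Omega> r B" "A \<subseteq> B"
  shows "independent U \<Omega> r A"
proof -
  have B: "subtransversal U \<Omega> B" "r B = card B"
    using assms(1) by (auto simp: independent_def)
  note A = subtransversal_subset[OF B(1) assms(2)]
  have "A \<union> (B - A) = B"
    using assms(2) by blast
  then have "card B \<le> r A + card (B - A)"
    using rank_union_le[of A "B - A"] B by simp
  moreover have "card (B - A) = card B - card A" "card A \<le> card B"
    using assms(2) subtransversal_finite[OF B(1)] subtransversal_finite[OF A]
    by (auto simp: card_Diff_subset card_mono)
  ultimately have "card A \<le> r A"
    by linarith
  then show ?thesis
    using rank_le_card[OF A] A by (simp add: independent_def)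
qed

text \<open>Non-degeneracy enters here: a class missed by a basis would have two elements, both in
  the closure of the basis by maximality, against (R2). Conversely, a transversal is maximal among
  subtransversals.\<close>

lemma basis_iff: "basis U \<Omega> r B \<longleftrightarrow> transversal U \<Omega> B \<and> r B = card B"
proof
  assume B: "basis U \<Omega> r B"
  then have ind: "subtransversal U \<Omega> B" "r B = card B"
    by (auto simp: basis_def independent_def)
  have "B \<inter> \<omega> \<noteq> {}" if \<omega>: "\<omega> \<in> \<Omega>" for \<omega>
  proof
    assume "B \<inter> \<omega> = {}"
    then have disj: "\<omega> \<inter> B = {}"
      by blast
    have "\<not> card \<omega> \<le> Suc 0"
      using nondegenerate \<omega> by (auto simp: nondegenerate_def)
    moreover have "finite \<omega>"
      using class_subset[OF \<omega>] finite_U finite_subset by blast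
    ultimately obtain x y where xy: "x \<in> \<omega>" "y \<in> \<omega>" "x \<noteq> y"
      by (auto simp: card_le_Suc0_iff_eq)
    have "r (insert z B) = r B" if "z \<in> \<omega>" for z
    proof -
      have st: "subtransversal U \<Omega> (insert z B)"
        using subtransversal_insert[OF ind(1) \<omega> disj that] .
      have "z \<notin> B"
        using that disj by blast
      then have "insert z B \<noteq> B"
        by blast
      then have "r (insert z B) \<noteq> card (insert z B)"
        using B st by (auto simp: basis_def independent_def)
      moreover have "card (insert z B) = card B + 1"
        using \<open>z \<notin> B\<close> subtransversal_finite[OF ind(1)] by simp
      ultimately show ?thesis
        using rank_insert_le[OF st] rank_mono[OF st, of B] ind(2) by fastforce
    qed
    then show False
      using rank_insert_unique[OF ind(1) \<omega> disj xy(1,2)] xy by blast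
  qed
  then show "transversal U \<Omega> B \<and> r B = card B"
    using ind by (simp add: transversal_iff)
next
  assume B: "transversal U \<Omega> B \<and> r B = card B"
  moreover have "S = B" if "subtransversal U \<Omega> S" "B \<subseteq> S" for S
  proof -
    have "x \<in> B" if "x \<in> S" for x
    proof -
      obtain \<omega> where "\<omega> \<in> \<Omega>" "x \<in> \<omega>"
        using in_class[OF \<open>subtransversal U \<Omega> S\<close> \<open>x \<in> S\<close>] by blast
      have "B \<inter> \<omega> \<noteq> {}"
        using B \<open>\<omega> \<in> \<Omega>\<close> by (simp add: transversal_iff)
      then obtain y where "y \<in> B" "y \<in> \<omega>"
        by blast
      then have "x = y"
        using subtransversal_eq[OF \<open>subtransversal U \<Omega> S\<close> \<open>\<omega> \<in> \<Omega>\<close> \<open>x \<in> S\<close>] \<open>x \<in> \<omega>\<close> \<open>B \<subseteq> S\<close> by blast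
      then show ?thesis
        using \<open>y \<in> B\<close> by simp
    qed
    then show ?thesis
      using \<open>B \<subseteq> S\<close> by blast
  qed
  ultimately show "basis U \<Omega> r B"
    by (auto simp: basis_def independent_def transversal_iff)
qed

lemma basis_subtransversal: "basis U \<Omega> r B \<Longrightarrow> subtransversal U \<Omega> B"
  by (simp add: basis_def independent_def)

lemma basis_elem_at:
  assumes "basis U \<Omega> r B" "\<omega> \<in> \<Omega>"
  shows "B \<inter> \<omega> = {elem_at B \<omega>}"
proof -
  have "card (B \<inter> \<omega>) = 1"
    using assms by (auto simp: basis_iff transversal_def)
  then show ?thesis
    unfolding elem_at_def by (metis card_1_singletonE the_elem_eq)
qed

lemma basis_eq_elem_at:
  assumes "basis U \<Omega> r B" "\<omega> \<in> \<Omega>" "x \<in> B" "x \<in> \<omega>"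
  shows "elem_at B \<omega> = x"
  using basis_elem_at[OF assms(1,2)] assms(3,4) by (metis IntI singletonD)

section \<open>Blocked elements and their invariance under exchanges\<close>

definition above :: "'a set \<Rightarrow> 'a set \<Rightarrow> 'a set" where
  "above B \<omega> = {y \<in> B. \<exists>\<omega>'\<in>\<Omega>. y \<in> \<omega>' \<and> (\<omega>, \<omega>') \<in> R}"

text \<open>The rank equation expresses membership in the closure of
  \<open>above B \<omega>\<close>. No circuit is mentioned, and only the part of \<open>B\<close>
  above \<open>\<omega>\<close> matters.\<close>

definition blocked :: "'a set \<Rightarrow> 'a set \<Rightarrow> 'a \<Rightarrow> bool" where
  "blocked B \<omega> x \<longleftrightarrow> x \<in> \<omega> \<and> r (insert x (above B \<omega>)) = r (above B \<omega>)"

lemma above_subset: "above B \<omega> \<subseteq> B"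
  by (auto simp: above_def)

lemma above_disjoint: "\<omega> \<in> \<Omega> \<Longrightarrow> \<omega> \<inter> above B \<omega> = {}"
  using class_unique prec_irrefl by (fastforce simp: above_def)

lemma above_mono: "(\<omega>, \<omega>') \<in> R \<Longrightarrow> above B \<omega>' \<subseteq> above B \<omega>"
  using prec_trans by (auto simp: above_def)

text \<open>Otherwise \<open>above B \<omega>\<close> and \<open>insert x (above B \<omega>)\<close>
  would be independent sets of equal rank but different size. This is why each active class
  contributes one choice fewer than its size.\<close>

lemma blocked_notin:
  assumes "basis U \<Omega> r B" "\<omega> \<in> \<Omega>" "blocked B \<omega> x"
  shows "x \<notin> B"
proof
  assume "x \<in> B"
  have B: "independent U \<Omega> r B"
    using assms(1) by (simp add: basis_def)
  have x: "x \<notin> above B \<omega>"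
    using assms above_disjoint by (auto simp: blocked_def)
  have "independent U \<Omega> r (above B \<omega>)" "independent U \<Omega> r (insert x (above B \<omega>))"
    using independent_subset[OF B] above_subset[of B \<omega>] \<open>x \<in> B\<close> by auto
  then have "card (above B \<omega>) = card (insert x (above B \<omega>))"
    using assms(3) by (simp add: blocked_def independent_def)
  moreover have "finite (above B \<omega>)"
    using subtransversal_finite[OF basis_subtransversal[OF assms(1)]] above_subset finite_subset
    by blast
  ultimately show False
    using x by simp
qed

lemma above_exchange:
  assumes "\<omega> \<in> \<Omega>" "B \<inter> \<omega> = {e}" "y \<in> \<omega>"
  shows "(\<omega>', \<omega>) \<in> R \<Longrightarrow> above (insert y (B - \<omega>)) \<omega>' = insert y (above B \<omega>' - \<omega>)"
    and "(\<omega>', \<omega>) \<notin> R \<Longrightarrow> above (insert y (B - \<omega>)) \<omega>' = above B \<omega>'"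
  using assms class_unique unfolding above_def by blast+

text \<open>Only classes below \<open>\<omega>\<close> see the exchange. For these, \<open>x\<close>
  turns out to be spanned by what is left after removing \<open>elem_at B \<omega>\<close>, so it
  remains spanned whichever \<open>y\<close> is put in its place.\<close>

lemma blocked_exchange_step:
  assumes B: "basis U \<Omega> r B" and \<omega>: "\<omega> \<in> \<Omega>" and b: "blocked B \<omega> b"
    and y: "y \<in> \<omega>" and \<omega>': "\<omega>' \<in> \<Omega>" and x: "blocked B \<omega>' x"
  shows "blocked (insert y (B - \<omega>)) \<omega>' x"
proof (cases "(\<omega>', \<omega>) \<in> R")
  case False
  then show ?thesis
    using above_exchange(2)[OF \<omega> basis_elem_at[OF B \<omega>] y False] x by (simp add: blocked_def)
next
  case True
  define e where "e = elem_at B \<omega>"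
  define S where "S = above B \<omega>' - \<omega>"
  have e: "B \<inter> \<omega> = {e}"
    using basis_elem_at[OF B \<omega>] by (simp add: e_def)
  have eS: "above B \<omega>' = insert e S"
    using e \<omega> True by (auto simp: S_def above_def)
  have ne: "\<omega> \<noteq> \<omega>'"
    using True prec_irrefl by blast
  have xb: "x \<in> \<omega>'" "b \<in> \<omega>" "e \<in> \<omega>"
    using x b e by (auto simp: blocked_def)
  have S: "subtransversal U \<Omega> S" "\<omega> \<inter> S = {}" "\<omega>' \<inter> S = {}"
    using subtransversal_subset[OF basis_subtransversal[OF B], of S] above_subset[of B \<omega>']
      above_disjoint[OF \<omega>', of B] by (auto simp: S_def)
  have xS: "subtransversal U \<Omega> (insert x S)"
    using subtransversal_insert[OF S(1) \<omega>' S(3) xb(1)] .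
  have xS_disj: "\<omega> \<inter> insert x S = {}"
    using S(2) xb(1) ne class_unique[OF \<omega> \<omega>'] by blast
  have zxS: "subtransversal U \<Omega> (insert z (insert x S))" if "z \<in> \<omega>" for z
    using subtransversal_insert[OF xS \<omega> xS_disj that] .
  have span: "r (insert x S) = r S"
  proof (rule ccontr)
    assume "r (insert x S) \<noteq> r S"
    then have "r (insert x S) = r S + 1"
      using rank_insert_le[OF xS] rank_mono[OF xS, of S] by fastforce
    \<comment> \<open>Since \<open>x\<close> is spanned by \<open>insert e S\<close>, adding
      \<open>e\<close> to \<open>insert x S\<close> yields rank at most \<open>r S + 1\<close>,
      which \<open>insert x S\<close> already has. Thus \<open>e\<close> lies in the closure of
      \<open>insert x S\<close>.\<close>
    moreover have "r (insert e S) \<le> r S + 1"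
      using rank_insert_le subtransversal_insert[OF S(1) \<omega> S(2) xb(3)] by blast
    moreover have "r (insert e (insert x S)) = r (insert e S)"
      using x by (simp add: blocked_def eS insert_commute)
    moreover have "r (insert x S) \<le> r (insert e (insert x S))"
      using rank_mono[OF zxS[OF xb(3)]] by blast
    ultimately have "r (insert e (insert x S)) = r (insert x S)"
      by simp
    \<comment> \<open>The closure of \<open>above B \<omega>\<close> contains \<open>b\<close>, and
      \<open>above B \<omega>\<close> lies in \<open>S\<close> because \<open>\<omega>'\<close>
      precedes \<open>\<omega>\<close>.\<close>
    moreover have "r (insert b (insert x S)) = r (insert x S)"
    proof (rule span_mono[OF _ _ zxS[OF xb(2)]])
      show "r (insert b (above B \<omega>)) = r (above B \<omega>)"
        using b by (simp add: blocked_def)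
      show "above B \<omega> \<subseteq> insert x S"
        using above_mono[OF True, of B] above_disjoint[OF \<omega>, of B] by (auto simp: S_def)
    qed
    ultimately have "e = b"
      using rank_insert_unique[OF xS \<omega> xS_disj xb(3,2)] by blast
    then show False
      using blocked_notin[OF B \<omega> b] e by blast
  qed
  have "r (insert x (insert y S)) = r (insert y S)"
    using span_mono[OF span, of "insert y S"] zxS[OF y] by (auto simp: insert_commute)
  then show ?thesis
    using above_exchange(1)[OF \<omega> e y True] xb(1) by (simp add: blocked_def S_def)
qed

text \<open>Since \<open>B - \<omega>\<close> contains \<open>above B \<omega>\<close>, its closure
  contains \<open>b\<close>. By (R2) every other \<open>y\<close> in \<open>\<omega>\<close> raises
  the rank, so the new transversal is independent.\<close>

lemma basis_exchange:
  assumes B: "basis U \<Omega> r B" and \<omega>: "\<omega> \<in> \<Omega>" and b: "blocked B \<omega> b"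
    and y: "y \<in> \<omega>" "y \<noteq> b"
  shows "basis U \<Omega> r (insert y (B - \<omega>))"
proof -
  let ?S = "B - \<omega>"
  note st = basis_subtransversal[OF B]
  have S: "subtransversal U \<Omega> ?S" "\<omega> \<inter> ?S = {}"
    using subtransversal_subset[OF st] by auto
  have yS: "subtransversal U \<Omega> (insert z ?S)" if "z \<in> \<omega>" for z
    using subtransversal_insert[OF S(1) \<omega> S(2) that] .
  have b\<omega>: "b \<in> \<omega>"
    using b by (simp add: blocked_def)
  have "r (insert b ?S) = r ?S"
    using b above_subset[of B \<omega>] above_disjoint[OF \<omega>, of B]
    by (intro span_mono[OF _ _ yS[OF b\<omega>], of "above B \<omega>"]) (auto simp: blocked_def)
  then have "r (insert y ?S) \<noteq> r ?S"
    using rank_insert_unique[OF S(1) \<omega> S(2) y(1) b\<omega>] y(2) by blast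
  then have "r ?S < r (insert y ?S)"
    using rank_mono[OF yS[OF y(1)], of ?S] by fastforce
  moreover have "r ?S = card ?S"
    using independent_subset[of B ?S] B by (auto simp: basis_def independent_def)
  moreover have "card (insert y ?S) = card ?S + 1"
    using y(1) subtransversal_finite[OF S(1)] by simp
  ultimately have "r (insert y ?S) = card (insert y ?S)"
    using rank_le_card[OF yS[OF y(1)]] by simp
  moreover have "insert y ?S \<inter> \<omega>' \<noteq> {}" if "\<omega>' \<in> \<Omega>" for \<omega>'
  proof (cases "\<omega>' = \<omega>")
    case False
    obtain z where "z \<in> B" "z \<in> \<omega>'"
      using basis_elem_at[OF B \<open>\<omega>' \<in> \<Omega>\<close>] by blast
    then show ?thesis
      using class_unique[OF that \<omega>, of z] False by blast
  qed (use y in blast)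
  ultimately show ?thesis
    using yS[OF y(1)] by (simp add: basis_iff transversal_iff)
qed

text \<open>The converse direction applies the one-step lemma to the reverse exchange:
  \<open>b\<close> stays blocked in the new basis, and putting \<open>elem_at B \<omega>\<close>
  back restores \<open>B\<close>.\<close>

lemma blocked_exchange:
  assumes B: "basis U \<Omega> r B" and \<omega>: "\<omega> \<in> \<Omega>" and b: "blocked B \<omega> b"
    and y: "y \<in> \<omega>" "y \<noteq> b" and \<omega>': "\<omega>' \<in> \<Omega>"
  shows "blocked (insert y (B - \<omega>)) \<omega>' x \<longleftrightarrow> blocked B \<omega>' x"
proof
  let ?B = "insert y (B - \<omega>)"
  assume x: "blocked ?B \<omega>' x"
  have e: "B \<inter> \<omega> = {elem_at B \<omega>}"
    using basis_elem_at[OF B \<omega>] .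
  have "blocked ?B \<omega> b"
    using blocked_exchange_step[OF B \<omega> b y(1) \<omega> b] .
  moreover have "insert (elem_at B \<omega>) (?B - \<omega>) = B"
    using e y(1) by blast
  moreover have "elem_at B \<omega> \<in> \<omega>"
    using e by blast
  ultimately show "blocked B \<omega>' x"
    using blocked_exchange_step[OF basis_exchange[OF B \<omega> b y] \<omega> _ _ \<omega>' x] by metis
qed (use blocked_exchange_step[OF B \<omega> b y(1) \<omega>'] in blast)

text \<open>The exchanges are made one class at a time. As each preserves all blocked elements, the
  elements \<open>b \<omega>\<close> chosen for \<open>B\<close> serve for every intermediate
  basis.\<close>

lemma multi_exchange:
  assumes B: "basis U \<Omega> r B" and "F \<subseteq> \<Omega>"
    and "\<And>\<omega>. \<omega> \<in> F \<Longrightarrow> blocked B \<omega> (b \<omega>)"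
    and "\<And>\<omega>. \<omega> \<in> F \<Longrightarrow> g \<omega> \<in> \<omega> \<and> g \<omega> \<noteq> b \<omega>"
  shows "basis U \<Omega> r ((B - \<Union>F) \<union> g ` F) \<and>
    (\<forall>\<omega>\<in>\<Omega>. \<forall>x. blocked ((B - \<Union>F) \<union> g ` F) \<omega> x \<longleftrightarrow> blocked B \<omega> x)"
proof -
  have "finite F"
    using finite_classes \<open>F \<subseteq> \<Omega>\<close> by (rule finite_subset[rotated])
  then show ?thesis
    using assms(2-)
  proof (induction F rule: finite_induct)
    case empty
    then show ?case
      using B by simp
  next
    case (insert \<omega> F)
    let ?B = "(B - \<Union>F) \<union> g ` F"
    have IH: "basis U \<Omega> r ?B" "\<forall>\<omega>\<in>\<Omega>. \<forall>x. blocked ?B \<omega> x \<longleftrightarrow> blocked B \<omega> x"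
      using insert by simp_all
    have \<omega>: "\<omega> \<in> \<Omega>" "g \<omega> \<in> \<omega>" "g \<omega> \<noteq> b \<omega>" and b: "blocked ?B \<omega> (b \<omega>)"
      using insert.prems IH by auto
    \<comment> \<open>Clearing the class \<open>\<omega>\<close> must not delete a choice made
      earlier in another class.\<close>
    have "g \<omega>' \<notin> \<omega>" if "\<omega>' \<in> F" for \<omega>'
      using class_unique[OF \<omega>(1), of \<omega>' "g \<omega>'"] that insert by auto
    then have "(B - \<Union>(insert \<omega> F)) \<union> g ` insert \<omega> F = insert (g \<omega>) (?B - \<omega>)"
      by auto
    then show ?case
      using basis_exchange[OF IH(1) \<omega>(1) b \<omega>(2,3)] blocked_exchange[OF IH(1) \<omega>(1) b \<omega>(2,3)] IH(2)
      by simp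
  qed
qed

section \<open>Circuits and uniqueness of the fundamental circuit\<close>

lemma circuit_dependent:
  assumes "circuit U \<Omega> r C"
  shows "subtransversal U \<Omega> C" "r C < card C"
  using assms by (auto simp: circuit_def dependent_def)

lemma circuit_psubset_independent:
  assumes "circuit U \<Omega> r C" "A \<subset> C"
  shows "independent U \<Omega> r A"
proof -
  have "subtransversal U \<Omega> A"
    using assms subtransversal_subset by (auto simp: circuit_def dependent_def)
  then show ?thesis
    using assms rank_le_card[of A] by (fastforce simp: circuit_def dependent_def independent_def)
qed

text \<open>By minimality \<open>C - {x}\<close> has rank \<open>card C - 1\<close>, which
  dependence of \<open>C\<close> does not let \<open>r C\<close> exceed. So each element of a
  circuit is spanned by the others.\<close>

lemma circuit_rank:
  assumes C: "circuit U \<Omega> r C" and x: "x \<in> C"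
  shows "r (C - {x}) = r C"
proof -
  have st: "subtransversal U \<Omega> C" and dep: "r C < card C"
    using circuit_dependent[OF C] by auto
  have "independent U \<Omega> r (C - {x})"
    using circuit_psubset_independent[OF C] x by blast
  then have "r (C - {x}) = card C - 1"
    using x by (simp add: independent_def card_Diff_singleton)
  then show ?thesis
    using dep rank_mono[OF st, of "C - {x}"] by fastforce
qed

lemma dependent_contains_circuit:
  assumes "dependent U \<Omega> r S"
  obtains C where "circuit U \<Omega> r C" "C \<subseteq> S"
proof -
  have "finite S"
    using assms subtransversal_finite by (auto simp: dependent_def)
  then have "finite {C. C \<subseteq> S \<and> dependent U \<Omega> r C}"
    by simp
  from finite_has_minimal2[OF this, of S] assms
  obtain C where C: "C \<subseteq> S" "dependent U \<Omega> r C"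
    and min: "\<forall>D\<in>{C. C \<subseteq> S \<and> dependent U \<Omega> r C}. D \<subseteq> C \<longrightarrow> C = D"
    by auto
  have "circuit U \<Omega> r C"
    using C min unfolding circuit_def by blast
  then show ?thesis
    using that C(1) by blast
qed

text \<open>Independence of \<open>B\<close> forces \<open>C\<close> to leave \<open>B\<close>,
  hence to meet \<open>\<omega>\<close>. Being a subtransversal, \<open>C\<close> has only this one
  element there, and the rest of \<open>C\<close> spans it.\<close>

lemma circuit_new_element:
  assumes B: "basis U \<Omega> r B" and \<omega>: "\<omega> \<in> \<Omega>" and C: "circuit U \<Omega> r C" "C \<subseteq> B \<union> \<omega>"
  obtains x where "x \<in> C" "x \<in> \<omega>" "C \<subseteq> insert x (B - \<omega>)" "r (insert x (B - \<omega>)) = r (B - \<omega>)"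
proof -
  have st: "subtransversal U \<Omega> C" and dep: "r C < card C"
    using circuit_dependent[OF C(1)] by auto
  have "\<not> C \<subseteq> B"
    using independent_subset[of B C] B dep by (auto simp: basis_def independent_def)
  then obtain x where x: "x \<in> C" "x \<in> \<omega>"
    using C by blast
  have "C \<inter> \<omega> = {x}"
    using subtransversal_inter[OF st \<omega> x] .
  then have sub: "C \<subseteq> insert x (B - \<omega>)"
    using C by blast
  have stx: "subtransversal U \<Omega> (insert x (B - \<omega>))"
    using subtransversal_insert[OF subtransversal_subset[OF basis_subtransversal[OF B] Diff_subset] \<omega> _ x(2)]
    by blast
  have "r (insert x (C - {x})) = r (C - {x})"
    using circuit_rank[OF C(1) x(1)] x(1) by (simp add: insert_absorb)
  then have "r (insert x (B - \<omega>)) = r (B - \<omega>)"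
    using span_mono[OF _ _ stx] sub by blast
  then show ?thesis
    using that x sub by blast
qed

text \<open>By (R2) both circuits have the same element \<open>x\<close> in \<open>\<omega>\<close>.
  Were they distinct, both \<open>C \<inter> D\<close> and \<open>(C \<union> D) - {x}\<close> would
  be independent, so submodularity would give \<open>r C + r D \<ge> card C + card D - 1\<close>,
  whereas dependence costs each circuit at least one.\<close>

lemma fundamental_circuit_unique:
  assumes B: "basis U \<Omega> r B" and \<omega>: "\<omega> \<in> \<Omega>"
    and C: "circuit U \<Omega> r C" "C \<subseteq> B \<union> \<omega>" and D: "circuit U \<Omega> r D" "D \<subseteq> B \<union> \<omega>"
  shows "C = D"
proof (rule ccontr)
  assume "C \<noteq> D"
  obtain x where x: "x \<in> C" "x \<in> \<omega>" "C \<subseteq> insert x (B - \<omega>)" "r (insert x (B - \<omega>)) = r (B - \<omega>)"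
    using circuit_new_element[OF B \<omega> C] .
  obtain y where y: "y \<in> D" "y \<in> \<omega>" "D \<subseteq> insert y (B - \<omega>)" "r (insert y (B - \<omega>)) = r (B - \<omega>)"
    using circuit_new_element[OF B \<omega> D] .
  have S: "subtransversal U \<Omega> (B - \<omega>)" "\<omega> \<inter> (B - \<omega>) = {}"
    using subtransversal_subset[OF basis_subtransversal[OF B]] by auto
  have xy: "y = x"
    using rank_insert_unique[OF S(1) \<omega> S(2) y(2) x(2) y(4) x(4)] .
  have st: "subtransversal U \<Omega> (C \<union> D)"
    by (rule subtransversal_subset[OF subtransversal_insert[OF S(1) \<omega> S(2) x(2)]])
      (use x(3) y(3) xy in blast)
  have fin: "finite C" "finite D"
    using subtransversal_finite[OF st] by auto
  have "\<not> C \<subseteq> D"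
    using \<open>C \<noteq> D\<close> C(1) D(1) unfolding circuit_def by blast
  then have "independent U \<Omega> r (C \<inter> D)"
    using circuit_psubset_independent[OF C(1)] by blast
  moreover have "(C \<union> D) - {x} \<subseteq> B"
    using x(3) y(3) xy by blast
  then have "independent U \<Omega> r ((C \<union> D) - {x})"
    using independent_subset B unfolding basis_def by blast
  ultimately have rk: "r (C \<inter> D) = card (C \<inter> D)" "r ((C \<union> D) - {x}) = card (C \<union> D) - 1"
    using x(1) by (simp_all add: independent_def card_Diff_singleton)
  have "r C < card C" "r D < card D"
    using circuit_dependent[OF C(1)] circuit_dependent[OF D(1)] by auto
  moreover have "r ((C \<union> D) - {x}) \<le> r (C \<union> D)"
    using rank_mono[OF st Diff_subset] .
  moreover have "card C + card D = card (C \<union> D) + card (C \<inter> D)"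
    using card_Un_Int[OF fin] .
  moreover have "card (C \<union> D) > 0"
    using x(1) fin by (metis UnI1 card_gt_0_iff empty_iff finite_UnI)
  ultimately show False
    using rank_submodular[OF st] rk by linarith
qed

lemma fund_circuit_eq:
  assumes "basis U \<Omega> r B" "\<omega> \<in> \<Omega>" "circuit U \<Omega> r C" "C \<subseteq> B \<union> \<omega>"
  shows "fund_circuit U \<Omega> r B \<omega> = C"
  unfolding fund_circuit_def
  using fundamental_circuit_unique[OF assms(1,2)] assms(3,4) by (intro the_equality) auto

section \<open>Minima of subtransversals and the description of activity by closure\<close>

lemma lift_order_iff:
  assumes "\<omega> \<in> \<Omega>" "x \<in> \<omega>" "\<omega>' \<in> \<Omega>" "y \<in> \<omega>'"
  shows "(x, y) \<in> lift_order \<Omega> R \<longleftrightarrow> (\<omega>, \<omega>') \<in> R"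
  using assms class_unique unfolding lift_order_def by blast

lemma min_elem_eq:
  assumes "m \<in> S" "\<And>y. y \<in> S \<Longrightarrow> y \<noteq> m \<Longrightarrow> (m, y) \<in> lift_order \<Omega> R"
  shows "min_elem \<Omega> R S = m"
  unfolding min_elem_def
proof (rule the_equality)
  fix x
  assume x: "x \<in> S \<and> (\<forall>y\<in>S. y \<noteq> x \<longrightarrow> (x, y) \<in> lift_order \<Omega> R)"
  show "x = m"
  proof (rule ccontr)
    assume "x \<noteq> m"
    then have mx: "(m, x) \<in> lift_order \<Omega> R" and xm: "(x, m) \<in> lift_order \<Omega> R"
      using x assms by auto
    from mx obtain \<omega> \<omega>' where "\<omega> \<in> \<Omega>" "\<omega>' \<in> \<Omega>" "m \<in> \<omega>" "x \<in> \<omega>'" "(\<omega>, \<omega>') \<in> R"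
      unfolding lift_order_def by blast
    moreover from this have "(\<omega>', \<omega>) \<in> R"
      using lift_order_iff xm by blast
    ultimately show False
      using prec_trans prec_irrefl by blast
  qed
qed (use assms in blast)

text \<open>Distinct elements of a subtransversal lie in distinct classes and are therefore
  comparable. With \<open>min_elem_eq\<close> this gives the description in \<open>min_elem\<close>
  a referent.\<close>

lemma subtransversal_minimum:
  assumes "subtransversal U \<Omega> S" "S \<noteq> {}"
  shows "\<exists>m\<in>S. \<forall>y\<in>S. y \<noteq> m \<longrightarrow> (m, y) \<in> lift_order \<Omega> R"
  using subtransversal_finite[OF assms(1)] assms(2,1)
proof (induction S rule: finite_ne_induct)
  case (singleton x)
  then show ?case
    by simp
next
  case (insert x S)
  then obtain m where m: "m \<in> S" "\<forall>y\<in>S. y \<noteq> m \<longrightarrow> (m, y) \<in> lift_order \<Omega> R"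
    using subtransversal_subset[of "insert x S" S] by auto
  obtain \<omega> \<omega>' where cl: "\<omega> \<in> \<Omega>" "x \<in> \<omega>" "\<omega>' \<in> \<Omega>" "m \<in> \<omega>'"
    using m(1) in_class[OF insert.prems, of x] in_class[OF insert.prems, of m] by blast
  have "x \<noteq> m"
    using insert m by blast
  then have "\<omega> \<noteq> \<omega>'"
    using subtransversal_eq[OF insert.prems cl(1), of x m] cl m(1) by blast
  then consider "(\<omega>, \<omega>') \<in> R" | "(\<omega>', \<omega>) \<in> R"
    using prec_total cl by blast
  then show ?case
  proof cases
    case 1
    have "(x, y) \<in> lift_order \<Omega> R" if "y \<in> S" for y
    proof (cases "y = m")
      case True
      then show ?thesis
        using 1 cl lift_order_iff by blast
    next
      case False
      then have "(m, y) \<in> lift_order \<Omega> R"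
        using m that by blast
      then obtain \<omega>1 \<omega>2 where "\<omega>1 \<in> \<Omega>" "\<omega>2 \<in> \<Omega>" "m \<in> \<omega>1" "y \<in> \<omega>2" "(\<omega>1, \<omega>2) \<in> R"
        unfolding lift_order_def by blast
      moreover from this have "\<omega>1 = \<omega>'"
        using cl class_unique by metis
      ultimately have "(\<omega>, \<omega>2) \<in> R"
        using 1 prec_trans by blast
      then show ?thesis
        using cl \<open>\<omega>2 \<in> \<Omega>\<close> \<open>y \<in> \<omega>2\<close> unfolding lift_order_def by blast
    qed
    then show ?thesis
      by blast
  next
    case 2
    then have "(m, x) \<in> lift_order \<Omega> R"
      using cl lift_order_iff by blast
    then show ?thesis
      using m by blast
  qed
qed

text \<open>If the minimum \<open>m\<close> of the fundamental circuit lies in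
  \<open>\<omega>\<close>, the rest of the circuit lies in \<open>above B \<omega>\<close> and spans
  \<open>m\<close>. Conversely, adding a blocked \<open>x\<close> to the independent set
  \<open>above B \<omega>\<close> creates a circuit through \<open>x\<close>, whose other elements
  all come after \<open>x\<close>.\<close>

lemma active_iff_blocked:
  assumes B: "basis U \<Omega> r B" and \<omega>: "\<omega> \<in> \<Omega>"
  shows "active U \<Omega> r R B \<omega> \<longleftrightarrow> (\<exists>x. blocked B \<omega> x)"
proof
  assume act: "active U \<Omega> r R B \<omega>"
  then obtain C where C: "circuit U \<Omega> r C" "C \<subseteq> B \<union> \<omega>"
    by (auto simp: active_def fund_circuit_exists_def)
  have min: "min_elem \<Omega> R C \<in> \<omega>"
    using act fund_circuit_eq[OF B \<omega> C] by (simp add: active_def)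
  have st: "subtransversal U \<Omega> C" and dep: "r C < card C"
    using circuit_dependent[OF C(1)] by auto
  have "C \<noteq> {}"
    using dep by auto
  then obtain m where m: "m \<in> C" "\<forall>y\<in>C. y \<noteq> m \<longrightarrow> (m, y) \<in> lift_order \<Omega> R"
    using subtransversal_minimum[OF st] by blast
  have m\<omega>: "m \<in> \<omega>"
    using min min_elem_eq m by metis
  have "C \<inter> \<omega> = {m}"
    using subtransversal_inter[OF st \<omega> m(1) m\<omega>] .
  then have "C - {m} \<subseteq> B"
    using C by blast
  have sub: "C - {m} \<subseteq> above B \<omega>"
  proof
    fix y
    assume y: "y \<in> C - {m}"
    then have "(m, y) \<in> lift_order \<Omega> R"
      using m by blast
    then obtain \<omega>1 \<omega>2 where "\<omega>1 \<in> \<Omega>" "\<omega>2 \<in> \<Omega>" "m \<in> \<omega>1" "y \<in> \<omega>2" "(\<omega>1, \<omega>2) \<in> R"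
      unfolding lift_order_def by blast
    moreover from this have "\<omega>1 = \<omega>"
      using class_unique \<omega> m\<omega> by metis
    ultimately show "y \<in> above B \<omega>"
      using y \<open>C - {m} \<subseteq> B\<close> unfolding above_def by blast
  qed
  have "r (insert m (C - {m})) = r (C - {m})"
    using circuit_rank[OF C(1) m(1)] m(1) by (simp add: insert_absorb)
  moreover have "subtransversal U \<Omega> (insert m (above B \<omega>))"
    using subtransversal_insert[OF _ \<omega> above_disjoint[OF \<omega>] m\<omega>]
      subtransversal_subset[OF basis_subtransversal[OF B] above_subset] by blast
  ultimately show "\<exists>x. blocked B \<omega> x"
    using span_mono[OF _ sub] m\<omega> by (auto simp: blocked_def)
next
  assume "\<exists>x. blocked B \<omega> x"
  then obtain x where x: "x \<in> \<omega>" "r (insert x (above B \<omega>)) = r (above B \<omega>)"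
    by (auto simp: blocked_def)
  have st: "subtransversal U \<Omega> (insert x (above B \<omega>))"
    using subtransversal_insert[OF _ \<omega> above_disjoint[OF \<omega>] x(1)]
      subtransversal_subset[OF basis_subtransversal[OF B] above_subset] by blast
  have ind: "independent U \<Omega> r (above B \<omega>)"
    using independent_subset[OF _ above_subset] B by (auto simp: basis_def)
  have "x \<notin> above B \<omega>"
    using above_disjoint[OF \<omega>] x by blast
  then have "card (insert x (above B \<omega>)) = card (above B \<omega>) + 1"
    using subtransversal_finite[OF st] by simp
  then have "dependent U \<Omega> r (insert x (above B \<omega>))"
    using st x ind by (simp add: dependent_def independent_def)
  then obtain C where C: "circuit U \<Omega> r C" "C \<subseteq> insert x (above B \<omega>)"
    using dependent_contains_circuit by blast
  have CB: "C \<subseteq> B \<union> \<omega>"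
    using C(2) above_subset[of B \<omega>] x(1) by blast
  have "\<not> C \<subseteq> above B \<omega>"
    using independent_subset[OF ind, of C] circuit_dependent(2)[OF C(1)]
    by (auto simp: independent_def)
  then have xC: "x \<in> C"
    using C(2) by blast
  have "min_elem \<Omega> R C = x"
  proof (rule min_elem_eq[OF xC])
    fix y
    assume "y \<in> C" "y \<noteq> x"
    then have "y \<in> above B \<omega>"
      using C(2) by blast
    then show "(x, y) \<in> lift_order \<Omega> R"
      using x(1) \<omega> unfolding above_def lift_order_def by blast
  qed
  then show "active U \<Omega> r R B \<omega>"
    using fund_circuit_eq[OF B \<omega> C(1) CB] C(1) CB x(1)
    by (auto simp: active_def fund_circuit_exists_def)
qed

lemma act_eq: "basis U \<Omega> r B \<Longrightarrow> act U \<Omega> r R B = {\<omega> \<in> \<Omega>. \<exists>x. blocked B \<omega> x}"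
  using active_iff_blocked by (auto simp: act_def)

section \<open>Equivalent bases and the size of an equivalence class\<close>

text \<open>Induction from the largest class downwards. Above \<open>\<omega>\<close> the basis
  \<open>B'\<close> avoids the elements \<open>b \<omega>'\<close> by the induction hypothesis, so
  \<open>B\<close> can be exchanged there to match \<open>B'\<close>. The result has the blocked
  elements of \<open>B\<close>, yet at \<open>\<omega>\<close> also those of \<open>B'\<close>,
  because the two agree above \<open>\<omega>\<close>.\<close>

lemma equiv_blocked:
  assumes B: "basis U \<Omega> r B" and B': "basis U \<Omega> r B'"
    and act: "act U \<Omega> r R B = act U \<Omega> r R B'"
    and inact: "\<And>\<omega>. \<omega> \<in> inact U \<Omega> r R B \<Longrightarrow> elem_at B \<omega> = elem_at B' \<omega>"
    and b: "\<And>\<omega>. \<omega> \<in> act U \<Omega> r R B \<Longrightarrow> blocked B \<omega> (b \<omega>)"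
    and \<omega>: "\<omega> \<in> act U \<Omega> r R B"
  shows "blocked B' \<omega> (b \<omega>)"
proof -
  \<comment> \<open>\<open>R\<close> may also relate sets outside \<open>\<Omega>\<close>; the
    restriction makes it finite, and the converse lets the induction start at the top.\<close>
  have "finite (R \<inter> \<Omega> \<times> \<Omega>)"
    using finite_classes by simp
  moreover have "acyclic (R \<inter> \<Omega> \<times> \<Omega>)"
  proof -
    have "trans (R \<inter> \<Omega> \<times> \<Omega>)"
      using prec_trans unfolding trans_def by blast
    then show ?thesis
      using prec_irrefl by (simp add: acyclic_def)
  qed
  ultimately have "wf ((R \<inter> \<Omega> \<times> \<Omega>)\<inverse>)"
    by (rule finite_acyclic_wf_converse)
  then show ?thesis
    using \<omega>
  proof (induction \<omega> rule: wf_induct_rule)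
    case (less \<omega>)
    let ?F = "{\<omega>' \<in> act U \<Omega> r R B. (\<omega>, \<omega>') \<in> R}"
    let ?g = "elem_at B'"
    let ?D = "(B - \<Union>?F) \<union> ?g ` ?F"
    have act_sub: "act U \<Omega> r R B \<subseteq> \<Omega>"
      by (auto simp: act_def)
    have \<omega>\<Omega>: "\<omega> \<in> \<Omega>"
      using less.prems act_sub by blast
    have at: "?g \<omega>' \<in> \<omega>'" "?g \<omega>' \<in> B'" if "\<omega>' \<in> \<Omega>" for \<omega>'
      using basis_elem_at[OF B' that] by auto
    have "?g \<omega>' \<in> \<omega>' \<and> ?g \<omega>' \<noteq> b \<omega>'" if "\<omega>' \<in> ?F" for \<omega>'
    proof -
      have "\<omega>' \<in> \<Omega>"
        using that act_sub by blast
      moreover from this have "blocked B' \<omega>' (b \<omega>')"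
        using less.IH[of \<omega>'] that \<omega>\<Omega> by blast
      ultimately show ?thesis
        using at[of \<omega>'] blocked_notin[OF B'] by metis
    qed
    then have D: "basis U \<Omega> r ?D" "\<forall>\<omega>\<in>\<Omega>. \<forall>x. blocked ?D \<omega> x \<longleftrightarrow> blocked B \<omega> x"
      using multi_exchange[OF B, of ?F b ?g] act_sub b by blast+
    have agree: "elem_at ?D \<omega>' = ?g \<omega>'" if R: "(\<omega>, \<omega>') \<in> R" and \<Omega>': "\<omega>' \<in> \<Omega>" for \<omega>'
    proof (cases "\<omega>' \<in> act U \<Omega> r R B")
      case True
      then show ?thesis
        using basis_eq_elem_at[OF D(1) \<Omega>'] at(1)[OF \<Omega>'] R by blast
    next
      case False
      \<comment> \<open>At inactive classes the two bases agree by equivalence, and the exchange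
        leaves these classes alone.\<close>
      then have "elem_at B \<omega>' = ?g \<omega>'"
        using inact \<Omega>' by (auto simp: inact_def act_def)
      moreover have "elem_at B \<omega>' \<in> B" "elem_at B \<omega>' \<in> \<omega>'"
        using basis_elem_at[OF B \<Omega>'] by auto
      moreover from this have "elem_at B \<omega>' \<notin> \<Union>?F"
        using False class_unique[OF \<Omega>'] act_sub by blast
      ultimately show ?thesis
        using basis_eq_elem_at[OF D(1) \<Omega>', of "elem_at B \<omega>'"] by simp
    qed
    have "?D \<inter> \<omega>' = B' \<inter> \<omega>'" if "(\<omega>, \<omega>') \<in> R" "\<omega>' \<in> \<Omega>" for \<omega>'
      using agree[OF that] basis_elem_at[OF D(1) that(2)] basis_elem_at[OF B' that(2)] by simp
    then have "above ?D \<omega> = above B' \<omega>"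
      unfolding above_def by blast
    then have "blocked ?D \<omega> (b \<omega>) \<longleftrightarrow> blocked B' \<omega> (b \<omega>)"
      unfolding blocked_def by simp
    then show ?case
      using D(2) \<omega>\<Omega> b[OF less.prems] by blast
  qed
qed

text \<open>The map \<open>?h\<close> is a bijection from the choices of an unblocked element at
  each active class to the equivalence class. Surjectivity rests on \<open>equiv_blocked\<close>: an
  equivalent basis avoids the same blocked elements.\<close>

theorem card_equiv_class:
  assumes B: "basis U \<Omega> r B"
  shows "card (basis_equiv U \<Omega> r R `` {B}) = (\<Prod>\<omega>\<in>act U \<Omega> r R B. (card \<omega> - 1))"
proof -
  define A where "A = act U \<Omega> r R B"
  have A: "A \<subseteq> \<Omega>"
    by (auto simp: A_def act_def)
  have inact: "inact U \<Omega> r R B = \<Omega> - A"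
    by (auto simp: A_def act_def inact_def)
  have "\<forall>\<omega>\<in>A. \<exists>x. blocked B \<omega> x"
    using act_eq[OF B] by (simp add: A_def)
  then obtain b where b: "\<And>\<omega>. \<omega> \<in> A \<Longrightarrow> blocked B \<omega> (b \<omega>)"
    by metis
  have b\<omega>: "b \<omega> \<in> \<omega>" if "\<omega> \<in> A" for \<omega>
    using b[OF that] by (simp add: blocked_def)
  \<comment> \<open>Extensional functions, so that a choice is determined by its values on
    \<open>A\<close> and \<open>?h\<close> can be injective.\<close>
  let ?P = "\<Pi>\<^sub>E \<omega>\<in>A. \<omega> - {b \<omega>}"
  let ?h = "\<lambda>g. (B - \<Union>A) \<union> g ` A"
  have h: "basis U \<Omega> r (?h g) \<and> (\<forall>\<omega>\<in>\<Omega>. \<forall>x. blocked (?h g) \<omega> x \<longleftrightarrow> blocked B \<omega> x)"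
    if "g \<in> ?P" for g
    using multi_exchange[OF B A b] that by (auto simp: PiE_iff)
  have h_at: "elem_at (?h g) \<omega> = g \<omega>" if "g \<in> ?P" "\<omega> \<in> A" for g \<omega>
  proof (rule basis_eq_elem_at)
    show "basis U \<Omega> r (?h g)"
      using h[OF that(1)] by blast
    show "\<omega> \<in> \<Omega>" "g \<omega> \<in> ?h g"
      using that(2) A by blast+
    show "g \<omega> \<in> \<omega>"
      using PiE_mem[OF that] by blast
  qed
  have inj: "inj_on ?h ?P"
  proof (rule inj_onI)
    fix g g'
    assume g: "g \<in> ?P" "g' \<in> ?P" "?h g = ?h g'"
    show "g = g'"
    proof (rule PiE_ext[OF g(1,2)])
      fix \<omega>
      assume \<omega>: "\<omega> \<in> A"
      have "g \<omega> = elem_at (?h g) \<omega>"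
        by (rule h_at[OF g(1) \<omega>, symmetric])
      also have "\<dots> = elem_at (?h g') \<omega>"
        by (rule arg_cong[OF g(3)])
      also have "\<dots> = g' \<omega>"
        by (rule h_at[OF g(2) \<omega>])
      finally show "g \<omega> = g' \<omega>" .
    qed
  qed
  have "?h ` ?P = basis_equiv U \<Omega> r R `` {B}"
  proof (intro equalityI subsetI)
    fix B'
    assume "B' \<in> ?h ` ?P"
    then obtain g where g: "g \<in> ?P" and B'_eq: "B' = ?h g"
      by blast
    have B': "basis U \<Omega> r B'" "\<forall>\<omega>\<in>\<Omega>. \<forall>x. blocked B' \<omega> x \<longleftrightarrow> blocked B \<omega> x"
      using h[OF g] B'_eq by auto
    then have "act U \<Omega> r R B = act U \<Omega> r R B'"
      using act_eq B by auto
    moreover have "elem_at B \<omega> = elem_at B' \<omega>" if "\<omega> \<in> \<Omega> - A" for \<omega>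
    proof -
      have "\<omega> \<in> \<Omega>"
        using that by blast
      then have e: "elem_at B \<omega> \<in> B" "elem_at B \<omega> \<in> \<omega>"
        using basis_elem_at[OF B] by auto
      then have "elem_at B \<omega> \<notin> \<Union>A"
        using that class_unique A by blast
      then have "elem_at B \<omega> \<in> B'"
        using B'_eq e by blast
      then show ?thesis
        using basis_eq_elem_at[OF B'(1) \<open>\<omega> \<in> \<Omega>\<close>] e by simp
    qed
    ultimately show "B' \<in> basis_equiv U \<Omega> r R `` {B}"
      using B B' inact by (auto simp: basis_equiv_def)
  next
    fix B'
    assume "B' \<in> basis_equiv U \<Omega> r R `` {B}"
    then have B': "basis U \<Omega> r B'" "act U \<Omega> r R B = act U \<Omega> r R B'"
      and eq: "\<And>\<omega>. \<omega> \<in> inact U \<Omega> r R B \<Longrightarrow> elem_at B \<omega> = elem_at B' \<omega>"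
      by (auto simp: basis_equiv_def)
    define g where "g = restrict (elem_at B') A"
    have at: "elem_at B' \<omega> \<in> \<omega>" "elem_at B' \<omega> \<in> B'" if "\<omega> \<in> \<Omega>" for \<omega>
      using basis_elem_at[OF B'(1) that] by auto
    have "elem_at B' \<omega> \<noteq> b \<omega>" if "\<omega> \<in> A" for \<omega>
    proof -
      have "blocked B' \<omega> (b \<omega>)"
        using equiv_blocked[OF B B' eq, of b \<omega>] b that by (simp add: A_def)
      then show ?thesis
        using blocked_notin[OF B'(1)] at(2) that A by (metis subsetD)
    qed
    then have g: "g \<in> ?P"
      using at(1) A by (auto simp: g_def PiE_iff)
    \<comment> \<open>One inclusion suffices: \<open>?h g\<close> is a basis, hence maximal, and
      \<open>B'\<close> is independent.\<close>
    have "?h g \<subseteq> B'"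
    proof
      fix x
      assume "x \<in> ?h g"
      then consider "x \<in> B" "x \<notin> \<Union>A" | "x \<in> g ` A"
        by blast
      then show "x \<in> B'"
      proof cases
        case 1
        obtain \<omega> where \<omega>: "\<omega> \<in> \<Omega>" "x \<in> \<omega>"
          using in_class[OF basis_subtransversal[OF B] 1(1)] by blast
        then have "\<omega> \<in> inact U \<Omega> r R B"
          using 1 inact by blast
        then show ?thesis
          using eq basis_eq_elem_at[OF B \<omega>(1) 1(1) \<omega>(2)] at(2)[OF \<omega>(1)] by metis
      next
        case 2
        then show ?thesis
          using at(2) A by (auto simp: g_def)
      qed
    qed
    moreover have "basis U \<Omega> r (?h g)"
      using h[OF g] by blast
    moreover have "independent U \<Omega> r B'"
      using B'(1) by (simp add: basis_def)
    ultimately have "B' = ?h g"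
      by (metis basis_def)
    then show "B' \<in> ?h ` ?P"
      using g by blast
  qed
  then have "card (basis_equiv U \<Omega> r R `` {B}) = card ?P"
    using card_image[OF inj] by simp
  also have "\<dots> = (\<Prod>\<omega>\<in>A. card (\<omega> - {b \<omega>}))"
    using finite_subset[OF A finite_classes] by (rule card_PiE)
  \<comment> \<open>The blocked element belongs to its class, so exactly one element is
    lost.\<close>
  also have "\<dots> = (\<Prod>\<omega>\<in>A. card \<omega> - 1)"
    using b\<omega> by (intro prod.cong) (auto simp: card_Diff_singleton)
  finally show ?thesis
    by (simp add: A_def)
qed

end

theorem theorem3p18:
  fixes U :: "'a set" and \<Omega> :: "'a set set" and r :: "'a set \<Rightarrow> nat"
    and R :: "('a set \<times> 'a set) set" and B :: "'a set"
  assumes "multimatroid U \<Omega> r"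
    and "nondegenerate \<Omega>"
    and "strict_linear_order_on \<Omega> R"
    and "basis U \<Omega> r B"
  shows "card (basis_equiv U \<Omega> r R `` {B}) = (\<Prod>\<omega>\<in>act U \<Omega> r R B. (card \<omega> - 1))"
proof -
  interpret ordered_multimatroid U \<Omega> r R
    using assms by unfold_locales
  show ?thesis
    using card_equiv_class assms by blast
qed

end
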